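(* There exists a nontrivial line segment $\mathcal L\subset\mathbb R^3$ which contains a badly approximable vector and such that every point of $\mathcal L$ admits an improvement in Dirichlet's theorem, i.e. every $\mathbf v\in\mathcal L$ belongs to $\mathrm{DI}(\sigma)$ for some $\sigma=\sigma(\mathbf v)\in(0,1)$.
   Context: $\|\cdot\|$ is the sup-norm on $\mathbb R^3$. For $\sigma\in(0,1)$, $\mathbf v\in\mathbb R^3$ belongs to $\mathrm{DI}(\sigma)$ if for all sufficiently large $Q$ there exist $q\in\mathbb N$, $\mathbf p\in\mathbb Z^3$ with $\|q\mathbf v-\mathbf p\|<\sigma Q^{-1/3}$ and $q<\sigma Q$. $\mathbf v$ is badly approximable if there is $c>0$ with $\|q\mathbf v-\mathbf p\|\ge c\,q^{-1/3}$ for all $q\in\mathbb N$, $\mathbf p\in\mathbb Z^3$. *)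

theory Defs
  imports "HOL-Analysis.Analysis"
begin

definition supnorm :: "real^3 \<Rightarrow> real" where
  "supnorm x = (MAX i\<in>UNIV. \<bar>x $ i\<bar>)"

definition int_vec :: "real^3 \<Rightarrow> bool" where
  "int_vec p \<longleftrightarrow> (\<forall>i. p $ i \<in> \<int>)"

definition DI :: "real \<Rightarrow> (real^3) set" where
  "DI \<sigma> = {v. \<exists>Q0. \<forall>Q\<ge>Q0. \<exists>q::nat. \<exists>p. q \<ge> 1 \<and> int_vec p \<and>
      supnorm (real q *\<^sub>R v - p) < \<sigma> * Q powr (-1/3) \<and> real q < \<sigma> * Q}"

definition badly_approximable :: "real^3 \<Rightarrow> bool" where
  "badly_approximable v \<longleftrightarrow> (\<exists>c>0. \<forall>q::nat. \<forall>p. q \<ge> 1 \<longrightarrow> int_vec p \<longrightarrow>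
      supnorm (real q *\<^sub>R v - p) \<ge> c * real q powr (-1/3))"

end

theory Submission
  imports Defs
begin

text \<open>
  The segment consists of the points v = (x, \<phi>, \<phi> x) with 0 \<le> x \<le> 1/1000, where \<phi> is the golden
  ratio. As (1, v) is an eigenvector of the integer map A (q, p1, p2, p3) = (p2, p3, q + p2, p1 + p3),
  the vectors (q, q v - p) form a module over the ring generated by \<phi>. In the coordinates
  s = q / Q and (a, t, b) = Q powr (1/3) * (q v - p), the unit \<phi> acts, up to small errors when x is
  small and Q is large, by s \<rightarrow> \<phi> s, t \<rightarrow> (1 - \<phi>) t, (a, b) \<rightarrow> (b, a + b). The union of the cube of side 2
  with its images under \<phi> and its inverse contains a symmetric convex body of volume
  (56 \<phi> - 40) / 3 > 16.8, whereas the cube has volume 16. By Minkowski's theorem a slightly shrunk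
  copy of the body contains a nonzero lattice point, which multiplication by 1, \<phi> or 1 / \<phi> moves into
  the interior of the cube.

  For x in a real quadratic field other than that of \<phi>, the entries of (1, v) span a quartic field,
  and bad approximability follows because the norm of a nonzero algebraic integer is at least 1.
\<close>

section \<open>Geometry of numbers: Blichfeldt's theorem\<close>

text \<open>Cut \<open>S\<close> along the half-open unit cells of the integer lattice and translate
  every piece back to the cell at the origin. Without two points that differ by a lattice vector,
  the translated pieces are disjoint subsets of the unit cube, so \<open>S\<close> has measure at
  most 1.\<close>

lemma blichfeldt:
  fixes S :: "'a::euclidean_space set"
  assumes S [measurable]: "S \<in> sets borel" and big: "emeasure lborel S > 1"
  obtains x y where "x \<in> S" "y \<in> S" "x \<noteq> y" "\<forall>i\<in>Basis. (x - y) \<bullet> i \<in> \<int>"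
proof (rule ccontr)
  assume neg: "\<not> thesis"
  \<comment> \<open>\<open>Z\<close> is the integer lattice and \<open>fl\<close> the componentwise
    floor. \<open>P z\<close> is the part of \<open>S\<close> in the cell with lower corner
    \<open>z\<close>, and \<open>T z\<close> is that part moved to the origin.\<close>
  define Z where "Z = {z::'a. \<forall>i\<in>Basis. z \<bullet> i \<in> \<int>}"
  define fl where "fl = (\<lambda>x::'a. \<Sum>i\<in>Basis. of_int \<lfloor>x \<bullet> i\<rfloor> *\<^sub>R i)"
  define P where "P = (\<lambda>z. {x \<in> S. fl x = z})"
  define T where "T = (\<lambda>z. (\<lambda>x. z + x) -` P z)"
  have fl_inner: "fl x \<bullet> i = of_int \<lfloor>x \<bullet> i\<rfloor>" if "i \<in> Basis" for x i
    using that by (simp add: fl_def inner_sum_left inner_Basis if_distrib cong: if_cong)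
  have flZ: "fl x \<in> Z" for x
    by (simp add: Z_def fl_inner)
  \<comment> \<open>Countability of the lattice is what allows countable additivity over the cells
    below.\<close>
  have "Z \<subseteq> (\<lambda>f. \<Sum>i\<in>Basis. f i *\<^sub>R i) ` (PiE Basis (\<lambda>_. \<int>))"
  proof
    fix z assume "z \<in> Z"
    then have "restrict (\<lambda>i. z \<bullet> i) Basis \<in> PiE Basis (\<lambda>_. \<int>)"
      by (auto simp: Z_def)
    moreover have "z = (\<Sum>i\<in>Basis. restrict (\<lambda>i. z \<bullet> i) Basis i *\<^sub>R i)"
      by (simp add: euclidean_representation)
    ultimately show "z \<in> (\<lambda>f. \<Sum>i\<in>Basis. f i *\<^sub>R i) ` (PiE Basis (\<lambda>_. \<int>))"
      by blast
  qed
  moreover have "countable (PiE (Basis::'a set) (\<lambda>_. \<int>::real set))"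
    by (intro countable_PiE finite_Basis) (simp add: Ints_def)
  ultimately have cZ: "countable Z"
    by (meson countable_image countable_subset)
  have fl_meas [measurable]: "fl \<in> borel_measurable borel"
    unfolding fl_def by measurable
  have P_meas [measurable]: "P z \<in> sets borel" for z
    unfolding P_def by measurable
  have T_meas [measurable]: "T z \<in> sets borel" for z
    unfolding T_def by (rule measurable_sets_borel[OF _ P_meas]) measurable
  have T_eq: "emeasure lborel (T z) = emeasure lborel (P z)" for z
  proof -
    have "emeasure lborel (P z) = emeasure (distr lborel borel ((+) z)) (P z)"
      by (simp add: lborel_distr_plus)
    also have "\<dots> = emeasure lborel (T z)"
      by (subst emeasure_distr) (simp_all add: T_def)
    finally show ?thesis by simp
  qed
  have disjP: "disjoint_family_on P Z"
    by (auto simp: disjoint_family_on_def P_def)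
  have disjT: "disjoint_family_on T Z"
    unfolding disjoint_family_on_def
  proof (intro ballI impI equals0I)
    fix z w u assume zw: "z \<in> Z" "w \<in> Z" "z \<noteq> w" "u \<in> T z \<inter> T w"
    then have "z + u \<in> S" "w + u \<in> S" "z + u \<noteq> w + u"
      by (auto simp: T_def P_def)
    moreover have "\<forall>i\<in>Basis. ((z + u) - (w + u)) \<bullet> i \<in> \<int>"
      using zw by (auto simp: Z_def inner_diff_left)
    ultimately show False using neg that by blast
  qed
  have TC: "T z \<subseteq> cbox 0 One" for z
  proof
    fix u assume "u \<in> T z"
    then have f: "fl (z + u) = z" by (auto simp: T_def P_def)
    show "u \<in> cbox 0 One"
      unfolding mem_box
    proof
      fix i :: 'a assume i: "i \<in> Basis"
      have "of_int \<lfloor>(z + u) \<bullet> i\<rfloor> = z \<bullet> i"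
        using fl_inner[OF i, of "z + u"] f by simp
      then show "0 \<bullet> i \<le> u \<bullet> i \<and> u \<bullet> i \<le> One \<bullet> i"
        using i by (simp add: inner_add_left) linarith
    qed
  qed
  have "emeasure lborel S = emeasure lborel (\<Union>z\<in>Z. P z)"
    using flZ by (intro arg_cong[where f="emeasure lborel"]) (auto simp: P_def)
  also have "\<dots> = (\<integral>\<^sup>+z. emeasure lborel (P z) \<partial>count_space Z)"
    using cZ disjP by (intro emeasure_UN_countable) auto
  also have "\<dots> = (\<integral>\<^sup>+z. emeasure lborel (T z) \<partial>count_space Z)"
    by (simp add: T_eq)
  also have "\<dots> = emeasure lborel (\<Union>z\<in>Z. T z)"
    using cZ disjT by (intro emeasure_UN_countable[symmetric]) auto
  also have "\<dots> \<le> emeasure lborel (cbox 0 One :: 'a set)"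
    using TC by (intro emeasure_mono) auto
  also have "\<dots> = 1"
    by (simp add: emeasure_lborel_cbox_eq)
  finally show False using big by simp
qed

section \<open>Sup-norm bounds and the action of the golden units\<close>

lemma supnorm_less_iff: "supnorm x < r \<longleftrightarrow> (\<forall>i. \<bar>x $ i\<bar> < r)"
  by (simp add: supnorm_def)

lemma supnorm_ge: "\<bar>x $ i\<bar> \<le> supnorm x"
  by (simp add: supnorm_def)

definition golden :: real where "golden = (1 + sqrt 5) / 2"

lemma golden_sq: "golden * golden = golden + 1"
  by (simp add: golden_def field_simps)

lemma golden_bounds: "1.618 < golden" "golden < 1.619"
proof -
  have "2.236 < sqrt 5" by (rule real_less_rsqrt) (simp add: power2_eq_square)
  then show "1.618 < golden" by (simp add: golden_def)
  have "sqrt 5 < 2.238" by (rule real_less_lsqrt) (simp_all add: power2_eq_square)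
  then show "golden < 1.619" by (simp add: golden_def)
qed

text \<open>The last two alternatives are the coordinates of the images under A and A - 1, the latter being the
  inverse of A; \<open>e\<close> stands for \<open>Q powr (-4/3)\<close>.\<close>

lemma golden_multiple:
  fixes x r :: real
  assumes r: "0 < r" and x: "\<bar>x\<bar> \<le> 1/1000"
    and e: "\<bar>e\<bar> * (golden * r) \<le> r / 1000"
    and a: "\<bar>a\<bar> \<le> r" and b: "\<bar>b\<bar> \<le> r"
    and K: "\<bar>s\<bar> + \<bar>t\<bar> \<le> golden * r"
      "\<bar>t\<bar> + (golden - 1) * \<bar>a + b\<bar> \<le> golden * r"
      "\<bar>s\<bar> + (golden - 1) * \<bar>a - b\<bar> \<le> golden * r"
  obtains "\<bar>s\<bar> \<le> r" "\<bar>t\<bar> \<le> r"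
  | "\<bar>golden * s - e * t\<bar> \<le> 1004/1000 * r" "\<bar>(1 - golden) * t\<bar> \<le> r"
    "\<bar>b - x * t\<bar> \<le> 1004/1000 * r" "\<bar>a + b - golden * x * t\<bar> \<le> 1004/1000 * r"
  | "\<bar>(golden - 1) * s - e * t\<bar> \<le> 1004/1000 * r" "\<bar>- golden * t\<bar> \<le> r"
    "\<bar>b - a - x * t\<bar> \<le> 1004/1000 * r" "\<bar>a - golden * x * t\<bar> \<le> 1004/1000 * r"
proof -
  let ?g = golden
  have g: "1.618 < ?g" "?g < 1.619" by (fact golden_bounds)+
  have gg: "?g * (?g - 1) = 1" using golden_sq by (simp add: algebra_simps)
  have tb: "\<bar>t\<bar> \<le> ?g * r" "\<bar>s\<bar> \<le> ?g * r" using K(1) by linarith+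
  have et: "\<bar>e * t\<bar> \<le> r / 1000"
    using mult_left_mono[OF tb(1), of "\<bar>e\<bar>"] e by (simp add: abs_mult)
  have xt: "\<bar>x * t\<bar> \<le> 1619/1000 * r / 1000"
  proof -
    have "\<bar>x * t\<bar> \<le> (1/1000) * (?g * r)"
      unfolding abs_mult using x tb(1) by (intro mult_mono) auto
    also have "\<dots> \<le> 1619/1000 * r / 1000" using g r by simp
    finally show ?thesis .
  qed
  have gxt: "\<bar>?g * x * t\<bar> \<le> 4/1000 * r"
  proof -
    have "\<bar>?g * x * t\<bar> = ?g * \<bar>x * t\<bar>" using g by (simp add: abs_mult)
    also have "\<dots> \<le> 1619/1000 * (1619/1000 * r / 1000)" using g xt r by (intro mult_mono) auto
    also have "\<dots> \<le> 4/1000 * r" using r by simp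
    finally show ?thesis .
  qed
  \<comment> \<open>The identity \<open>golden * (golden - 1) = 1\<close> drives the next three
    facts: the slack \<open>(golden - 1) * r\<close> that a large \<open>s\<close> or
    \<open>t\<close> leaves in \<open>K\<close> is exactly what multiplication by
    \<open>golden\<close> can absorb.\<close>
  have small: "w \<le> r" if "0 \<le> w" "(?g - 1) * w \<le> (?g - 1) * r" for w
    using that g by (simp add: mult_le_cancel_left)
  have up: "?g * u \<le> r" if "u \<le> (?g - 1) * r" for u
    using mult_left_mono[OF that, of ?g] g gg by (simp add: mult.assoc[symmetric])
  have down: "(?g - 1) * u \<le> r" if "u \<le> ?g * r" for u
    using mult_left_mono[OF that, of "?g - 1"] g gg by (simp add: mult.assoc[symmetric] mult.commute)
  \<comment> \<open>The factor 1004/1000 leaves room for the error terms; the largest of them is at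
    most \<open>golden * golden * r / 1000\<close>, which is below
    \<open>4/1000 * r\<close>.\<close>
  have tri: "\<bar>u - w\<bar> \<le> 1004/1000 * r" if "\<bar>u\<bar> \<le> r" "\<bar>w\<bar> \<le> 4/1000 * r" for u w
    using that by linarith
  have et': "\<bar>e * t\<bar> \<le> 4/1000 * r" using et r by linarith
  have xt': "\<bar>x * t\<bar> \<le> 4/1000 * r" using xt r by linarith
  \<comment> \<open>If \<open>t\<close> is too large, \<open>K\<close> forces \<open>s\<close> and
    \<open>a + b\<close> to be small, and multiplication by \<open>golden\<close>, which contracts
    \<open>t\<close>, succeeds. If \<open>s\<close> is too large, \<open>t\<close> and
    \<open>a - b\<close> are small, and the inverse, which contracts \<open>s\<close>,
    succeeds.\<close>
  consider "\<bar>s\<bar> \<le> r" "\<bar>t\<bar> \<le> r" | "\<bar>t\<bar> > r" | "\<bar>s\<bar> > r" by linarith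
  then show thesis
  proof cases
    case 1 then show thesis by (rule that(1))
  next
    case 2
    have "\<bar>s\<bar> \<le> (?g - 1) * r" using 2 K(1) by (simp add: algebra_simps)
    then have "?g * \<bar>s\<bar> \<le> r" by (rule up)
    then have s: "\<bar>?g * s\<bar> \<le> r" using g by (simp add: abs_mult)
    have "\<bar>a + b\<bar> \<le> r" using 2 K(2) by (intro small) (auto simp: algebra_simps)
    moreover have "\<bar>(1 - ?g) * t\<bar> \<le> r"
      using down[OF tb(1)] g by (simp add: abs_mult)
    ultimately show thesis
      using s by (intro that(2) tri et' xt' gxt b)
  next
    case 3
    have "\<bar>t\<bar> \<le> (?g - 1) * r" using 3 K(1) by (simp add: algebra_simps)
    then have "?g * \<bar>t\<bar> \<le> r" by (rule up)
    then have t: "\<bar>- ?g * t\<bar> \<le> r" using g by (simp add: abs_mult)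
    have "\<bar>a - b\<bar> \<le> r" using 3 K(3) by (intro small) (auto simp: algebra_simps)
    moreover have "\<bar>(?g - 1) * s\<bar> \<le> r"
      using down[OF tb(2)] g by (simp add: abs_mult)
    ultimately show thesis
      using t \<open>\<bar>a - b\<bar> \<le> r\<close> by (intro that(3) tri et' xt' gxt a) (simp_all add: abs_minus_commute)
  qed
qed

section \<open>The volume of the convex body\<close>

text \<open>The integral is the area of the square
  \<open>\<bar>s\<bar> + \<bar>t\<bar> \<le> L\<close>, namely \<open>2*L\<^sup>2\<close>, with its
  four corners cut off by \<open>\<bar>s\<bar> \<le> L - u\<close> and
  \<open>\<bar>t\<bar> \<le> L - w\<close>. Two corners have area \<open>u\<^sup>2\<close> and two
  have area \<open>w\<^sup>2\<close>; they do not overlap because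
  \<open>u + w \<le> L\<close>.\<close>

lemma nn_integral_truncated_tent:
  fixes L u w :: real
  assumes "0 \<le> u" "0 \<le> w" "u + w \<le> L"
  shows "(\<integral>\<^sup>+s. indicator {u-L..L-u} s * ennreal (2 * min (L - \<bar>s\<bar>) (L - w)) \<partial>lborel)
    = ennreal (2*L\<^sup>2 - 2*u\<^sup>2 - 2*w\<^sup>2)"
proof -
  let ?f = "\<lambda>s. 2 * min (L - \<bar>s\<bar>) (L - w)"
  have FTC: "(?f has_integral F b - F a) {a..b}"
    if "a \<le> b" "\<And>s. (F has_real_derivative F' s) (at s)" "\<And>s. s \<in> {a..b} \<Longrightarrow> F' s = ?f s"
    for F F' and a b :: real
  proof -
    have "(F' has_integral F b - F a) {a..b}"
      using that(1,2) by (intro fundamental_theorem_of_calculus)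
        (auto simp flip: has_real_derivative_iff_has_vector_derivative intro: DERIV_subset)
    then show ?thesis by (rule has_integral_eq[rotated]) (use that(3) in auto)
  qed
  \<comment> \<open>The minimum changes branch at \<open>-w\<close> and \<open>w\<close>, so the
    interval splits into two sloping pieces and a plateau.\<close>
  have 1: "(?f has_integral (2*L*(-w) + (-w)\<^sup>2) - (2*L*(u-L) + (u-L)\<^sup>2)) {u-L..-w}"
    by (rule FTC[where F="\<lambda>x. 2*L*x + x\<^sup>2" and F'="\<lambda>x. 2*L + 2*x"])
       (use assms in \<open>auto intro!: derivative_eq_intros simp: min_def\<close>)
  have 2: "(?f has_integral 2*(L-w)*w - 2*(L-w)*(-w)) {-w..w}"
    by (rule FTC[where F="\<lambda>x. 2*(L-w)*x" and F'="\<lambda>x. 2*(L-w)"])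
       (use assms in \<open>auto intro!: derivative_eq_intros simp: min_def\<close>)
  have 3: "(?f has_integral (2*L*(L-u) - (L-u)\<^sup>2) - (2*L*w - w\<^sup>2)) {w..L-u}"
    by (rule FTC[where F="\<lambda>x. 2*L*x - x\<^sup>2" and F'="\<lambda>x. 2*L - 2*x"])
       (use assms in \<open>auto intro!: derivative_eq_intros simp: min_def\<close>)
  have "(?f has_integral 2*L\<^sup>2 - 2*u\<^sup>2 - 2*w\<^sup>2) {u-L..L-u}"
    using has_integral_combine[OF _ _ has_integral_combine[OF _ _ 1 2] 3] assms
    by (simp add: algebra_simps power2_eq_square)
  \<comment> \<open>The passage to the Lebesgue integral asks for an integrand that is nonnegative
    everywhere; \<open>max 0\<close> changes nothing on the interval.\<close>
  then have "((\<lambda>s. max 0 (?f s)) has_integral 2*L\<^sup>2 - 2*u\<^sup>2 - 2*w\<^sup>2) {u-L..L-u}"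
    by (rule has_integral_eq[rotated]) (use assms in auto)
  from nn_integral_has_integral_lebesgue[OF _ this]
  have *: "(\<integral>\<^sup>+s. ennreal (indicator {u-L..L-u} s * max 0 (?f s)) \<partial>lborel)
    = ennreal (2*L\<^sup>2 - 2*u\<^sup>2 - 2*w\<^sup>2)" by simp
  show ?thesis
    unfolding *[symmetric]
    by (intro nn_integral_cong) (auto simp: indicator_def max_def ennreal_neg)
qed

text \<open>The convex body inside the union of the cube of half-width \<open>h\<close> and its images under the two units.\<close>

definition body :: "real \<Rightarrow> real \<Rightarrow> real \<Rightarrow> real \<Rightarrow> real \<Rightarrow> bool" where
  "body h s a b t \<longleftrightarrow> \<bar>a\<bar> \<le> h \<and> \<bar>b\<bar> \<le> h \<and> \<bar>s\<bar> + \<bar>t\<bar> \<le> golden * h \<and>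
     \<bar>t\<bar> + (golden - 1) * \<bar>a + b\<bar> \<le> golden * h \<and> \<bar>s\<bar> + (golden - 1) * \<bar>a - b\<bar> \<le> golden * h"

lemma measurable_body [measurable (raw)]:
  assumes [measurable]: "s \<in> borel_measurable M" "a \<in> borel_measurable M"
    "b \<in> borel_measurable M" "t \<in> borel_measurable M"
  shows "Measurable.pred M (\<lambda>x. body h (s x) (a x) (b x) (t x))"
  unfolding body_def by measurable

text \<open>Every constraint bounds a sum of seminorms by a multiple of \<open>h\<close>, so the
  triangle inequality applies. This convexity and symmetry turns a pair from
  \<open>blichfeldt\<close> into the lattice point of Minkowski's theorem.\<close>

lemma body_diff:
  assumes "body h s1 a1 b1 t1" "body h s2 a2 b2 t2"
  shows "body (2 * h) (s1 - s2) (a1 - a2) (b1 - b2) (t1 - t2)"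
proof -
  have c: "0 \<le> golden - 1" using golden_bounds by simp
  have scale: "(golden - 1) * \<bar>u1 - u2\<bar> \<le> (golden - 1) * \<bar>u1\<bar> + (golden - 1) * \<bar>u2\<bar>" for u1 u2
    unfolding distrib_left[symmetric] by (intro mult_left_mono abs_triangle_ineq4 c)
  have add: "X + Y \<le> golden * (2 * h)"
    if "X \<le> A1 + A2" "Y \<le> B1 + B2" "A1 + B1 \<le> golden * h" "A2 + B2 \<le> golden * h" for X Y A1 A2 B1 B2
    using that by linarith
  have regroup: "a1 - a2 + (b1 - b2) = (a1 + b1) - (a2 + b2)" "a1 - a2 - (b1 - b2) = (a1 - b1) - (a2 - b2)"
    by simp_all
  have bound: "\<bar>u1 - u2\<bar> \<le> 2 * h" if "\<bar>u1\<bar> \<le> h" "\<bar>u2\<bar> \<le> h" for u1 u2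
    using that by linarith
  note 1 = assms(1)[unfolded body_def] and 2 = assms(2)[unfolded body_def]
  show ?thesis
    unfolding body_def regroup
  proof (intro conjI)
    show "\<bar>a1 - a2\<bar> \<le> 2 * h" "\<bar>b1 - b2\<bar> \<le> 2 * h"
      using 1 2 by (blast intro: bound)+
    show "\<bar>s1 - s2\<bar> + \<bar>t1 - t2\<bar> \<le> golden * (2 * h)"
      using 1 2 by (blast intro: add[OF abs_triangle_ineq4 abs_triangle_ineq4])
    show "\<bar>t1 - t2\<bar> + (golden - 1) * \<bar>a1 + b1 - (a2 + b2)\<bar> \<le> golden * (2 * h)"
      using 1 2 by (blast intro: add[OF abs_triangle_ineq4 scale])
    show "\<bar>s1 - s2\<bar> + (golden - 1) * \<bar>a1 - b1 - (a2 - b2)\<bar> \<le> golden * (2 * h)"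
      using 1 2 by (blast intro: add[OF abs_triangle_ineq4 scale])
  qed
qed

text \<open>For fixed \<open>a\<close> and \<open>b\<close> the section in \<open>s\<close> and
  \<open>t\<close> is a square with cut corners, whose area is quadratic in \<open>a\<close> and
  \<open>b\<close>. Integrating it over the square of half-width \<open>h\<close> gives
  \<open>8 * golden\<^sup>2 - 32/3 * (golden - 1)\<^sup>2\<close> times \<open>h ^ 4\<close>, which
  \<open>golden_sq\<close> reduces to the stated constant.\<close>

lemma body_volume:
  assumes h: "0 \<le> h"
  shows "ennreal ((56 * golden - 40) / 3 * h ^ 4) \<le>
    (\<integral>\<^sup>+s. \<integral>\<^sup>+a. \<integral>\<^sup>+b. \<integral>\<^sup>+t. indicator {t. body h s a b t} t \<partial>lborel \<partial>lborel \<partial>lborel \<partial>lborel)"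
proof -
  let ?g = golden let ?c = "golden - 1" let ?L = "golden * h"
  let ?I = "\<lambda>x. indicator {-h..h} x :: ennreal"
  have g: "1.618 < ?g" "?g < 1.619" by (fact golden_bounds)+
  have gg: "?g * ?g = ?g + 1" by (rule golden_sq)
  define f where "f s a b = (\<integral>\<^sup>+t. indicator {t. body h s a b t} t \<partial>lborel)" for s a b
  have inner: "ennreal (2*?L\<^sup>2 - 4*?c\<^sup>2*(a\<^sup>2+b\<^sup>2)) \<le> (\<integral>\<^sup>+s. f s a b \<partial>lborel)"
    if a: "\<bar>a\<bar> \<le> h" and b: "\<bar>b\<bar> \<le> h" for a b
  proof -
    let ?u = "?c * \<bar>a - b\<bar>" let ?w = "?c * \<bar>a + b\<bar>"
    \<comment> \<open>The corners do not overlap: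
      \<open>\<bar>a - b\<bar> + \<bar>a + b\<bar>\<close> is twice the larger of
      \<open>\<bar>a\<bar>\<close> and \<open>\<bar>b\<bar>\<close>, and
      \<open>2 * (golden - 1) \<le> golden\<close>.\<close>
    have "?u + ?w = ?c * (\<bar>a - b\<bar> + \<bar>a + b\<bar>)" by (simp add: algebra_simps)
    also have "\<dots> \<le> ?c * (2 * h)" using a b g by (intro mult_left_mono) auto
    also have "\<dots> \<le> ?L" using g h mult_right_mono[of ?g 2 h] by (simp add: algebra_simps)
    finally have uw: "?u + ?w \<le> ?L" .
    have uw0: "0 \<le> ?u" "0 \<le> ?w" using g by auto
    \<comment> \<open>This is the parallelogram law for \<open>a\<close> and
      \<open>b\<close>.\<close>
    have eq: "2*?L\<^sup>2 - 2*?u\<^sup>2 - 2*?w\<^sup>2 = 2*?L\<^sup>2 - 4*?c\<^sup>2*(a\<^sup>2+b\<^sup>2)"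
      by (simp add: power_mult_distrib) (simp add: power2_eq_square algebra_simps)
    have "ennreal (2*?L\<^sup>2 - 4*?c\<^sup>2*(a\<^sup>2+b\<^sup>2)) = (\<integral>\<^sup>+s. indicator {?u-?L..?L-?u} s *
        ennreal (2 * min (?L - \<bar>s\<bar>) (?L - ?w)) \<partial>lborel)"
      unfolding nn_integral_truncated_tent[OF uw0 uw] eq ..
    also have "\<dots> \<le> (\<integral>\<^sup>+s. f s a b \<partial>lborel)"
    proof (intro nn_integral_mono)
      fix s
      let ?m = "min (?L - \<bar>s\<bar>) (?L - ?w)"
      have abs_bound: "\<bar>s\<bar> + u \<le> L" if "s \<in> {u-L..L-u}" for s u L :: real
        using that by auto
      have ball: "{t. \<bar>t\<bar> \<le> m1 \<and> \<bar>t\<bar> \<le> m2} = {- min m1 m2..min m1 m2}" for m1 m2 :: real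
        by auto
      have shift: "(A \<and> B \<and> s + t \<le> L \<and> t + w \<le> L \<and> s + u \<le> L) = (t \<le> L - s \<and> t \<le> L - w)"
        if "s + u \<le> L" A B for A B and s t u w L :: real
        using that by auto
      show "indicator {?u-?L..?L-?u} s * ennreal (2 * ?m) \<le> f s a b"
      proof (cases "s \<in> {?u-?L..?L-?u} \<and> 0 \<le> ?m")
        case True
        have su: "\<bar>s\<bar> + ?u \<le> ?L" using True by (intro abs_bound) blast
        have "body h s a b t \<longleftrightarrow> \<bar>t\<bar> \<le> ?L - \<bar>s\<bar> \<and> \<bar>t\<bar> \<le> ?L - ?w" for t
          unfolding body_def by (rule shift[OF su a b])
        then have "{t. body h s a b t} = {t. \<bar>t\<bar> \<le> ?L - \<bar>s\<bar> \<and> \<bar>t\<bar> \<le> ?L - ?w}"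
          by (simp only:)
        then have "f s a b = emeasure lborel {- ?m..?m}"
          unfolding f_def ball by (simp only: nn_integral_indicator sets_lborel borel_closed closed_real_atLeastAtMost)
        also have "\<dots> = ennreal (2 * ?m)"
          using True by (subst emeasure_lborel_Icc) (linarith, simp only: mult_2 diff_minus_eq_add)
        finally show ?thesis using True by (simp only: indicator_simps mult_1 order_refl)
      next
        case False
        then have "s \<notin> {?u-?L..?L-?u} \<or> 2 * ?m \<le> 0" by argo
        then show ?thesis
          by (elim disjE) (simp_all only: indicator_simps ennreal_neg mult_zero_left mult_zero_right zero_le not_False_eq_True)
      qed
    qed
    finally show ?thesis .
  qed
  have I1: "?I x = 1" if "\<bar>x\<bar> \<le> h" for x
    using that by (auto simp: indicator_def)
  have I0: "?I x = 0" if "\<not> \<bar>x\<bar> \<le> h" for x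
    using that by (auto simp: indicator_def)
  have pos: "0 \<le> 2*?L\<^sup>2 - 4*?c\<^sup>2*(a\<^sup>2+b\<^sup>2)" if a: "\<bar>a\<bar> \<le> h" and b: "\<bar>b\<bar> \<le> h" for a b
  proof -
    have "a\<^sup>2 \<le> h\<^sup>2" "b\<^sup>2 \<le> h\<^sup>2" using power_mono[OF a, of 2] power_mono[OF b, of 2] by simp_all
    then have "4*?c\<^sup>2*(a\<^sup>2+b\<^sup>2) \<le> 4*?c\<^sup>2*(2*h\<^sup>2)" by (intro mult_left_mono) auto
    also have "\<dots> = 8*?c\<^sup>2*h\<^sup>2" by simp
    also have "8*?c\<^sup>2*h\<^sup>2 \<le> 2*?g\<^sup>2*h\<^sup>2"
      using g gg by (intro mult_right_mono) (auto simp: power2_eq_square algebra_simps)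
    finally show ?thesis by (simp add: power_mult_distrib)
  qed
  have cell_b: "(\<integral>\<^sup>+b. ennreal (2*?L\<^sup>2 - 4*?c\<^sup>2*(a\<^sup>2+b\<^sup>2)) * ?I b \<partial>lborel)
      = ennreal (4*?L\<^sup>2*h - 4*?c\<^sup>2*(2*a\<^sup>2*h + 2*h^3/3))" if a: "\<bar>a\<bar> \<le> h" for a
  proof -
    let ?F = "\<lambda>b. 2*?L\<^sup>2*b - 4*?c\<^sup>2*(a\<^sup>2*b+b^3/3)"
    have "(\<integral>\<^sup>+b. ennreal (2*?L\<^sup>2 - 4*?c\<^sup>2*(a\<^sup>2+b\<^sup>2)) * ?I b \<partial>lborel) = ennreal (?F h - ?F (-h))"
      by (rule nn_integral_FTC_Icc)
         (use h pos[OF a] in \<open>auto intro!: derivative_eq_intros simp: algebra_simps power2_eq_square abs_le_iff\<close>)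
    also have "?F h - ?F (-h) = 4*?L\<^sup>2*h - 4*?c\<^sup>2*(2*a\<^sup>2*h + 2*h^3/3)"
      by (simp add: algebra_simps)
    finally show ?thesis .
  qed
  have pos2: "0 \<le> 4*?L\<^sup>2*h - 4*?c\<^sup>2*(2*a\<^sup>2*h + 2*h^3/3)" if a: "\<bar>a\<bar> \<le> h" for a
  proof -
    \<comment> \<open>The inner integral is written as \<open>2 * h\<close> times the integrand at
      the endpoint \<open>b = h\<close>, where it is smallest, plus a nonnegative remainder.\<close>
    have "0 \<le> 2 * h * (2*?L\<^sup>2 - 4*?c\<^sup>2*(a\<^sup>2+h\<^sup>2)) + 4*?c\<^sup>2*(4*h^3/3)"
      using pos[OF a, of h] h by (intro add_nonneg_nonneg mult_nonneg_nonneg) auto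
    also have "\<dots> = 4*?L\<^sup>2*h - 4*?c\<^sup>2*(2*a\<^sup>2*h + 2*h^3/3)"
      by (simp add: field_simps power2_eq_square power3_eq_cube)
    finally show ?thesis .
  qed
  let ?G = "\<lambda>a. 4*?L\<^sup>2*h*a - 4*?c\<^sup>2*(2*h*a^3/3 + 2*h^3/3*a)"
  have vol: "(56 * ?g - 40) / 3 * h ^ 4 = ?G h - ?G (-h)"
  proof -
    have c2: "?c\<^sup>2 = 2 - ?g" "?g\<^sup>2 = ?g + 1" using gg by (simp_all add: power2_eq_square algebra_simps)
    show ?thesis
      by (simp add: power_mult_distrib c2) (simp add: field_simps power2_eq_square power3_eq_cube power4_eq_xxxx)
  qed
  have "ennreal ((56 * ?g - 40) / 3 * h ^ 4) =
      (\<integral>\<^sup>+a. ennreal (4*?L\<^sup>2*h - 4*?c\<^sup>2*(2*a\<^sup>2*h + 2*h^3/3)) * ?I a \<partial>lborel)"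
    unfolding vol
  proof (rule nn_integral_FTC_Icc[symmetric])
    show "(?G has_real_derivative 4*?L\<^sup>2*h - 4*?c\<^sup>2*(2*a\<^sup>2*h + 2*h^3/3)) (at a)" for a
      by (auto intro!: derivative_eq_intros simp: field_simps power2_eq_square)
    show "0 \<le> 4*?L\<^sup>2*h - 4*?c\<^sup>2*(2*a\<^sup>2*h + 2*h^3/3)" if "a \<in> {-h..h}" for a
      using that by (intro pos2 abs_leI) auto
  qed (use h in auto)
  also have "\<dots> = (\<integral>\<^sup>+a. (\<integral>\<^sup>+b. ennreal (2*?L\<^sup>2 - 4*?c\<^sup>2*(a\<^sup>2+b\<^sup>2)) * ?I b \<partial>lborel) * ?I a \<partial>lborel)"
  proof (intro nn_integral_cong)
    fix a
    show "ennreal (4*?L\<^sup>2*h - 4*?c\<^sup>2*(2*a\<^sup>2*h + 2*h^3/3)) * ?I a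
        = (\<integral>\<^sup>+b. ennreal (2*?L\<^sup>2 - 4*?c\<^sup>2*(a\<^sup>2+b\<^sup>2)) * ?I b \<partial>lborel) * ?I a"
    proof (cases "\<bar>a\<bar> \<le> h")
      case True
      show ?thesis unfolding cell_b[OF True] ..
    next
      case False
      show ?thesis by (simp only: I0[OF False] mult_zero_right)
    qed
  qed
  also have "\<dots> \<le> (\<integral>\<^sup>+a. \<integral>\<^sup>+b. \<integral>\<^sup>+s. f s a b \<partial>lborel \<partial>lborel \<partial>lborel)"
  proof (intro nn_integral_mono)
    fix a
    show "(\<integral>\<^sup>+b. ennreal (2*?L\<^sup>2 - 4*?c\<^sup>2*(a\<^sup>2+b\<^sup>2)) * ?I b \<partial>lborel) * ?I a
        \<le> (\<integral>\<^sup>+b. \<integral>\<^sup>+s. f s a b \<partial>lborel \<partial>lborel)"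
    proof (cases "\<bar>a\<bar> \<le> h")
      case True
      have "(\<integral>\<^sup>+b. ennreal (2*?L\<^sup>2 - 4*?c\<^sup>2*(a\<^sup>2+b\<^sup>2)) * ?I b \<partial>lborel)
          \<le> (\<integral>\<^sup>+b. \<integral>\<^sup>+s. f s a b \<partial>lborel \<partial>lborel)"
      proof (intro nn_integral_mono)
        fix b
        show "ennreal (2*?L\<^sup>2 - 4*?c\<^sup>2*(a\<^sup>2+b\<^sup>2)) * ?I b \<le> (\<integral>\<^sup>+s. f s a b \<partial>lborel)"
          using inner[OF True, of b] I1[of b] I0[of b]
          by (cases "\<bar>b\<bar> \<le> h") (simp_all only: mult_1_right mult_zero_right zero_le not_False_eq_True)
      qed
      then show ?thesis by (simp only: I1[OF True] mult_1_right)
    next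
      case False
      show ?thesis by (simp only: I0[OF False] mult_zero_right zero_le)
    qed
  qed
  \<comment> \<open>The sections were integrated over \<open>s\<close> first; two exchanges move
    \<open>s\<close> to the outside.\<close>
  also have "\<dots> = (\<integral>\<^sup>+a. \<integral>\<^sup>+s. \<integral>\<^sup>+b. f s a b \<partial>lborel \<partial>lborel \<partial>lborel)"
    unfolding f_def by (rule nn_integral_cong, rule lborel_pair.Fubini') measurable
  also have "\<dots> = (\<integral>\<^sup>+s. \<integral>\<^sup>+a. \<integral>\<^sup>+b. f s a b \<partial>lborel \<partial>lborel \<partial>lborel)"
    unfolding f_def by (rule lborel_pair.Fubini') measurable
  finally show ?thesis unfolding f_def .
qed

section \<open>The change to lattice coordinates\<close>

lemma nn_integral_reflect_scale:
  fixes f :: "real \<Rightarrow> ennreal"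
  assumes [measurable]: "f \<in> borel_measurable borel" and R: "0 < R"
  shows "(\<integral>\<^sup>+x. f (R * (c - x)) \<partial>lborel) = ennreal (1 / R) * (\<integral>\<^sup>+x. f x \<partial>lborel)"
proof -
  have "(\<integral>\<^sup>+x. f x \<partial>lborel) = ennreal R * (\<integral>\<^sup>+x. f (R * c + (- R) * x) \<partial>lborel)"
    using R by (subst nn_integral_real_affine[of f "-R" "R * c"]) auto
  then show ?thesis
    using R by (simp add: mult.assoc[symmetric] ennreal_mult[symmetric] right_diff_distrib)
qed

text \<open>The substitutions in \<open>t\<close>, \<open>b\<close> and \<open>a\<close> contribute
  \<open>1 / R\<close> each, and the one in \<open>q\<close> contributes \<open>R^3\<close>. Hence
  pulling the body back to the coordinates of the integer lattice preserves its volume.\<close>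

lemma nn_integral_unimodular:
  fixes f :: "real \<times> real \<times> real \<times> real \<Rightarrow> ennreal"
  assumes f [measurable]: "f \<in> borel_measurable (borel \<Otimes>\<^sub>M borel \<Otimes>\<^sub>M borel \<Otimes>\<^sub>M borel)"
    and R: "0 < R"
  shows "(\<integral>\<^sup>+q. \<integral>\<^sup>+a. \<integral>\<^sup>+b. \<integral>\<^sup>+t. f (q / R^3, R * (q * \<alpha> - a), R * (q * \<beta> - b), R * (q * \<gamma> - t))
      \<partial>lborel \<partial>lborel \<partial>lborel \<partial>lborel)
    = (\<integral>\<^sup>+q. \<integral>\<^sup>+a. \<integral>\<^sup>+b. \<integral>\<^sup>+t. f (q, a, b, t) \<partial>lborel \<partial>lborel \<partial>lborel \<partial>lborel)"
proof -
  let ?r = "ennreal (1 / R)"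
  define f3 where "f3 s a b = (\<integral>\<^sup>+t. f (s, a, b, t) \<partial>lborel)" for s a b
  define f2 where "f2 s a = (\<integral>\<^sup>+b. f3 s a b \<partial>lborel)" for s a
  define f1 where "f1 s = (\<integral>\<^sup>+a. f2 s a \<partial>lborel)" for s
  have [measurable]: "(\<lambda>(s,a,b). f3 s a b) \<in> borel_measurable (borel \<Otimes>\<^sub>M borel \<Otimes>\<^sub>M borel)"
    unfolding f3_def by measurable
  have [measurable]: "(\<lambda>(s,a). f2 s a) \<in> borel_measurable (borel \<Otimes>\<^sub>M borel)"
    unfolding f2_def f3_def by measurable
  have [measurable]: "f1 \<in> borel_measurable borel"
    unfolding f1_def f2_def f3_def by measurable
  have 3: "(\<integral>\<^sup>+t. f (s, a, b, R * (c - t)) \<partial>lborel) = ?r * f3 s a b" for s a b c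
    unfolding f3_def by (rule nn_integral_reflect_scale[OF _ R]) measurable
  have 2: "(\<integral>\<^sup>+b. ?r * f3 s a (R * (c - b)) \<partial>lborel) = ?r * (?r * f2 s a)" for s a c
    unfolding f2_def by (subst nn_integral_cmult, measurable, subst nn_integral_reflect_scale[OF _ R], measurable)
  have 1: "(\<integral>\<^sup>+a. ?r * (?r * f2 s (R * (c - a))) \<partial>lborel) = ?r * (?r * (?r * f1 s))" for s c
    unfolding f1_def
    by (subst nn_integral_cmult, measurable, subst nn_integral_cmult, measurable,
        subst nn_integral_reflect_scale[OF _ R], measurable)
  have "(\<integral>\<^sup>+q. \<integral>\<^sup>+a. \<integral>\<^sup>+b. \<integral>\<^sup>+t. f (q / R^3, R * (q * \<alpha> - a), R * (q * \<beta> - b), R * (q * \<gamma> - t))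
      \<partial>lborel \<partial>lborel \<partial>lborel \<partial>lborel) = (\<integral>\<^sup>+q. ?r * (?r * (?r * f1 (q / R^3))) \<partial>lborel)"
    by (simp add: 1 2 3)
  also have "\<dots> = (\<integral>\<^sup>+q. ennreal (1 / R^3) * f1 (q / R^3) \<partial>lborel)"
    using R by (simp add: mult.assoc[symmetric] ennreal_mult[symmetric] power3_eq_cube)
  also have "\<dots> = ennreal (1 / R^3) * (\<integral>\<^sup>+q. f1 (0 + (1 / R^3) * q) \<partial>lborel)"
    by (subst nn_integral_cmult) auto
  also have "\<dots> = (\<integral>\<^sup>+q. f1 q \<partial>lborel)"
    using R nn_integral_real_affine[of f1 "1 / R^3" 0] by simp
  finally show ?thesis by (simp add: f1_def f2_def f3_def)
qed

section \<open>Norms in a quartic field and bad approximability\<close>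

text \<open>The form is the norm of \<open>r + s * golden\<close>. It has no nontrivial zero modulo
  2, so a zero can be halved indefinitely.\<close>

lemma golden_norm_eq_0:
  fixes r s :: int
  assumes "r\<^sup>2 + r * s - s\<^sup>2 = 0"
  shows "r = 0 \<and> s = 0"
  using assms
proof (induction "nat (\<bar>r\<bar> + \<bar>s\<bar>)" arbitrary: r s rule: less_induct)
  case less
  have "even (r\<^sup>2 + r * s - s\<^sup>2)" using less.prems by simp
  then have "even r \<and> even s" by auto
  then obtain r' s' where rs: "r = 2 * r'" "s = 2 * s'" by (auto elim!: evenE)
  have "r'\<^sup>2 + r' * s' - s'\<^sup>2 = 0"
    using less.prems by (simp add: rs power2_eq_square)
  moreover have "nat (\<bar>r'\<bar> + \<bar>s'\<bar>) < nat (\<bar>r\<bar> + \<bar>s\<bar>)" if "\<not> (r' = 0 \<and> s' = 0)"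
    using that unfolding rs by linarith
  ultimately have "r' = 0 \<and> s' = 0"
    using less.hyps[of r' s'] by blast
  then show ?case by (simp add: rs)
qed

text \<open>The equations compare coefficients in
  \<open>(a + b * golden)\<^sup>2 = 2 * (c + d * golden)\<^sup>2\<close>, so 2 is not a square in
  the field of \<open>golden\<close>. Descent works because the squares are even only when both
  coefficients are.\<close>

lemma two_not_square_golden:
  fixes a b c d :: int
  assumes "a\<^sup>2 + b\<^sup>2 = 2 * (c\<^sup>2 + d\<^sup>2)" "2 * a * b + b\<^sup>2 = 2 * (2 * c * d + d\<^sup>2)"
  shows "a = 0 \<and> b = 0 \<and> c = 0 \<and> d = 0"
  using assms
proof (induction "nat (\<bar>a\<bar> + \<bar>b\<bar> + \<bar>c\<bar> + \<bar>d\<bar>)" arbitrary: a b c d rule: less_induct)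
  case less
  have "even (2 * a * b + b\<^sup>2)" "even (a\<^sup>2 + b\<^sup>2)" unfolding less.prems by simp_all
  then have "even a \<and> even b" by auto
  then obtain a' b' where ab: "a = 2 * a'" "b = 2 * b'" by (auto elim!: evenE)
  have cd': "c\<^sup>2 + d\<^sup>2 = 2 * (a'\<^sup>2 + b'\<^sup>2)" "2 * c * d + d\<^sup>2 = 2 * (2 * a' * b' + b'\<^sup>2)"
    using less.prems unfolding ab by (simp_all add: power2_eq_square algebra_simps)
  have "even (2 * c * d + d\<^sup>2)" "even (c\<^sup>2 + d\<^sup>2)" unfolding cd' by simp_all
  then have "even c \<and> even d" by auto
  then obtain c' d' where cd: "c = 2 * c'" "d = 2 * d'" by (auto elim!: evenE)
  have "a'\<^sup>2 + b'\<^sup>2 = 2 * (c'\<^sup>2 + d'\<^sup>2)" "2 * a' * b' + b'\<^sup>2 = 2 * (2 * c' * d' + d'\<^sup>2)"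
    using cd' unfolding cd by (simp_all add: power2_eq_square algebra_simps)
  moreover have "nat (\<bar>a'\<bar> + \<bar>b'\<bar> + \<bar>c'\<bar> + \<bar>d'\<bar>) < nat (\<bar>a\<bar> + \<bar>b\<bar> + \<bar>c\<bar> + \<bar>d\<bar>)"
    if "\<not> (a' = 0 \<and> b' = 0 \<and> c' = 0 \<and> d' = 0)"
  proof -
    let ?N = "\<bar>a'\<bar> + \<bar>b'\<bar> + \<bar>c'\<bar> + \<bar>d'\<bar>"
    have "\<bar>a\<bar> + \<bar>b\<bar> + \<bar>c\<bar> + \<bar>d\<bar> = 2 * ?N" by (simp add: ab cd abs_mult)
    moreover have "0 \<le> ?N" "?N \<noteq> 0" using that by (simp_all add: add_nonneg_eq_0_iff)
    moreover have "nat N < nat (2 * N)" if "0 \<le> N" "N \<noteq> 0" for N :: int using that by simp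
    ultimately show ?thesis by presburger
  qed
  ultimately have "a' = 0 \<and> b' = 0 \<and> c' = 0 \<and> d' = 0"
    using less.hyps[of a' b' c' d'] by blast
  then show ?case by (simp add: ab cd)
qed

text \<open>The product is the norm of \<open>(a + b * golden) + (c + d * golden) * sqrt 2\<close>.
  It is a nonzero integer: \<open>r + s * golden\<close> is the relative norm over the field of
  \<open>golden\<close>, and its own norm is \<open>r\<^sup>2 + r * s - s\<^sup>2\<close>.\<close>

lemma quartic_norm_ge_1:
  fixes a b c d :: int
  assumes "\<not> (a = 0 \<and> b = 0 \<and> c = 0 \<and> d = 0)"
  shows "1 \<le> \<bar>((a + b * golden)\<^sup>2 - 2 * (c + d * golden)\<^sup>2) *
     ((a + b * (1 - golden))\<^sup>2 - 2 * (c + d * (1 - golden))\<^sup>2)\<bar>"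
proof -
  let ?g = golden
  define r where "r = a\<^sup>2 + b\<^sup>2 - 2 * (c\<^sup>2 + d\<^sup>2)"
  define s where "s = 2 * a * b + b\<^sup>2 - 2 * (2 * c * d + d\<^sup>2)"
  have "\<not> (r = 0 \<and> s = 0)"
    using two_not_square_golden[of a b c d] assms by (auto simp: r_def s_def)
  then have "r\<^sup>2 + r * s - s\<^sup>2 \<noteq> 0" using golden_norm_eq_0 by blast
  then have ge: "1 \<le> \<bar>r\<^sup>2 + r * s - s\<^sup>2\<bar>" by linarith
  have sq: "(u + w * t)\<^sup>2 = u\<^sup>2 + w\<^sup>2 + (2 * u * w + w\<^sup>2) * t" if "t * t = t + 1" for u w t :: real
  proof -
    have "(u + w * t)\<^sup>2 = u\<^sup>2 + 2 * u * w * t + w\<^sup>2 * (t * t)"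
      by (simp add: power2_eq_square algebra_simps)
    then show ?thesis by (simp add: that algebra_simps)
  qed
  have conj: "(1 - ?g) * (1 - ?g) = (1 - ?g) + 1" using golden_sq by (simp add: algebra_simps)
  have "(a + b * ?g)\<^sup>2 - 2 * (c + d * ?g)\<^sup>2 = r + s * ?g"
    unfolding sq[OF golden_sq] by (simp add: r_def s_def algebra_simps)
  moreover have "(a + b * (1 - ?g))\<^sup>2 - 2 * (c + d * (1 - ?g))\<^sup>2 = r + s * (1 - ?g)"
    unfolding sq[OF conj] by (simp add: r_def s_def algebra_simps)
  moreover have "(r + s * ?g) * (r + s * (1 - ?g)) = r\<^sup>2 + r * s + s\<^sup>2 * (?g - ?g * ?g)"
    by (simp add: algebra_simps power2_eq_square)
  ultimately have "((a + b * ?g)\<^sup>2 - 2 * (c + d * ?g)\<^sup>2) *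
     ((a + b * (1 - ?g))\<^sup>2 - 2 * (c + d * (1 - ?g))\<^sup>2) = real_of_int (r\<^sup>2 + r * s - s\<^sup>2)"
    by (simp add: golden_sq)
  then show ?thesis using ge by (simp only: of_int_abs[symmetric])
qed

text \<open>The integers \<open>q\<close>, \<open>p1\<close>, \<open>p2\<close>, \<open>p3\<close>
  are packed into one algebraic integer \<open>n + sqrt 2 * y2\<close>, the factor 2000 clearing
  denominators. Three conjugates are of order \<open>d\<close> and one of order \<open>q\<close>, so
  the lower bound 1 for the norm bounds \<open>d ^ 3 * q\<close> from below.\<close>

lemma badly_approximable_quartic:
  "badly_approximable (vector [sqrt 2 / 2000, golden, golden * (sqrt 2 / 2000)])"
  (is "badly_approximable ?v")
  unfolding badly_approximable_def
\<comment> \<open>The bounds on the conjugates multiply to \<open>6 * 10^14 * d ^ 3 * q\<close>,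
  which is at most \<open>(10^5 * d) ^ 3 * q\<close>.\<close>
proof (intro exI[of _ "1 / 10^5"] conjI allI impI)
  fix q :: nat and p :: "real^3"
  assume q: "1 \<le> q" and p: "int_vec p"
  let ?g = golden
  define d where "d = supnorm (real q *\<^sub>R ?v - p)"
  define k where "k = real q powr (-1/3)"
  have g: "1.618 < ?g" "?g < 1.619" by (fact golden_bounds)+
  have k: "0 < k" "k \<le> 1" "k ^ 3 * real q = 1"
  proof -
    show "0 < k" using q by (simp add: k_def)
    show "k \<le> 1" using q powr_mono[of "-1/3" 0 "real q"] by (simp add: k_def)
    have "k ^ 3 = real q powr (-1)"
      using q by (simp add: k_def powr_powr flip: powr_realpow)
    then show "k ^ 3 * real q = 1" using q by (simp add: powr_minus)
  qed
  obtain p1 p2 p3 :: int where p123: "p $ 1 = p1" "p $ 2 = p2" "p $ 3 = p3"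
    using p by (auto simp: int_vec_def elim!: Ints_cases) (metis Ints_cases)
  have s2: "1.41 < sqrt 2" "sqrt 2 < 1.42"
    by (rule real_less_rsqrt real_less_lsqrt; simp add: power2_eq_square)+
  define y1 where "y1 = q * (sqrt 2 / 2000) - real_of_int p1"
  define y2 where "y2 = q * ?g - real_of_int p2"
  define y3 where "y3 = q * (?g * (sqrt 2 / 2000)) - real_of_int p3"
  have y: "\<bar>y1\<bar> \<le> d" "\<bar>y2\<bar> \<le> d" "\<bar>y3\<bar> \<le> d"
    using supnorm_ge[of "real q *\<^sub>R ?v - p" 1] supnorm_ge[of "real q *\<^sub>R ?v - p" 2]
      supnorm_ge[of "real q *\<^sub>R ?v - p" 3]
    by (simp_all add: d_def y1_def y2_def y3_def p123)
  have "k \<le> 10^5 * d"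
  proof (cases "d < 1")
    case False
    then show ?thesis using k by simp
  next
    case True
    have d0: "0 \<le> d" using y by linarith
    \<comment> \<open>In \<open>n\<close> the terms with \<open>q\<close> cancel. Replacing
      \<open>golden\<close> by its conjugate \<open>1 - golden\<close> turns \<open>n\<close> and
      \<open>y2\<close> into \<open>n'\<close> and \<open>m'\<close>.\<close>
    define n n' m' where "n = 2000 * y3 - 2000 * (?g * y1)"
      and "n' = (1 - ?g) * (2000 * real_of_int p1) - 2000 * real_of_int p3" and "m' = q * (1 - ?g) - real_of_int p2"
    have gy: "\<bar>?g * y1\<bar> \<le> 1619/1000 * d"
      unfolding abs_mult using g y d0 by (intro mult_mono) auto
    have gy': "\<bar>(?g - 1) * y1\<bar> \<le> 619/1000 * d"
      unfolding abs_mult using g y d0 by (intro mult_mono) auto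
    have sy: "\<bar>sqrt 2 * y2\<bar> \<le> 142/100 * d"
      unfolding abs_mult using s2 y d0 by (intro mult_mono) auto
    have scaled: "2000 * y1 = q * sqrt 2 - 2000 * real_of_int p1" "2000 * y3 = q * (?g * sqrt 2) - 2000 * real_of_int p3"
      by (simp_all add: y1_def y3_def)
    \<comment> \<open>Of the conjugates \<open>n \<plusminus> sqrt 2 * y2\<close> and \<open>n' \<plusminus> sqrt 2 * m'\<close> only \<open>n' + sqrt 2 * m'\<close> is not
      bounded by a multiple of d; it is bounded by a multiple of q.\<close>
    have n: "n = (- 2000 * real_of_int p3) + (2000 * real_of_int p1) * ?g"
      unfolding n_def using scaled by algebra
    have nb: "\<bar>n\<bar> \<le> 5300 * d"
      unfolding n_def using gy y by linarith
    have first: "\<bar>n\<^sup>2 - 2 * y2\<^sup>2\<bar> \<le> 30000000 * d\<^sup>2"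
    proof -
      have "n\<^sup>2 \<le> 28090000 * d\<^sup>2"
        using power_mono[OF nb, of 2] by (simp add: power_mult_distrib)
      moreover have "y2\<^sup>2 \<le> d\<^sup>2"
        using power_mono[OF y(2), of 2] by simp
      moreover have "0 \<le> n\<^sup>2" "0 \<le> y2\<^sup>2" "0 \<le> d\<^sup>2" by simp_all
      ultimately show ?thesis by linarith
    qed
    have minus: "n' - sqrt 2 * m' = 2000 * y3 + 2000 * ((?g - 1) * y1) - sqrt 2 * y2"
      unfolding n'_def m'_def y2_def using scaled by algebra
    then have second: "\<bar>n' - sqrt 2 * m'\<bar> \<le> 4000 * d"
      using gy' sy y by linarith
    have "1 \<le> real q" using q by simp
    \<comment> \<open>The assumption \<open>d < 1\<close> enters here, so that the error
      \<open>d\<close> is absorbed into \<open>q\<close>.\<close>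
    have "\<bar>m'\<bar> \<le> 4 * real q"
    proof -
      have "m' = y2 - (2 * ?g - 1) * real q"
        unfolding m'_def y2_def by algebra
      moreover have "(2 * ?g - 1) * real q \<le> 3 * real q" "0 \<le> (2 * ?g - 1) * real q"
        using g by (simp_all add: mult_right_mono)
      moreover have "\<bar>u - w\<bar> \<le> 4 * z" if "\<bar>u\<bar> \<le> d" "w \<le> 3 * z" "0 \<le> w" "1 \<le> z" for u w z
        using that True by linarith
      ultimately show ?thesis using y(2) \<open>1 \<le> real q\<close> by blast
    qed
    then have "\<bar>sqrt 2 * m'\<bar> \<le> 142/100 * (4 * real q)"
      unfolding abs_mult using s2 by (intro mult_mono) auto
    then have third: "\<bar>n' + sqrt 2 * m'\<bar> \<le> 5000 * real q"
      using second True \<open>1 \<le> real q\<close> by linarith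
    have "1 \<le> \<bar>(n\<^sup>2 - 2 * y2\<^sup>2) * (n'\<^sup>2 - 2 * m'\<^sup>2)\<bar>"
    proof -
      have "n = real_of_int (- 2000 * p3) + real_of_int (2000 * p1) * ?g"
        "n' = real_of_int (- 2000 * p3) + real_of_int (2000 * p1) * (1 - ?g)"
        "y2 = real_of_int (- p2) + real_of_int (int q) * ?g"
        "m' = real_of_int (- p2) + real_of_int (int q) * (1 - ?g)"
        by (simp_all add: n n'_def m'_def y2_def)
      then show ?thesis
        using quartic_norm_ge_1[of "- 2000 * p3" "2000 * p1" "- p2" "int q"] q by simp
    qed
    also have "n'\<^sup>2 - 2 * m'\<^sup>2 = (n' - sqrt 2 * m') * (n' + sqrt 2 * m')"
      by (simp add: square_diff_square_factored[symmetric] power_mult_distrib algebra_simps power2_eq_square)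
    also have "\<bar>(n\<^sup>2 - 2 * y2\<^sup>2) * ((n' - sqrt 2 * m') * (n' + sqrt 2 * m'))\<bar>
        \<le> (30000000 * d\<^sup>2) * ((4000 * d) * (5000 * q))"
      unfolding abs_mult using first second third d0 by (intro mult_mono) auto
    also have "\<dots> \<le> (10^5 * d) ^ 3 * q"
      using d0 by (simp add: power2_eq_square power3_eq_cube)
    finally have "k ^ 3 * q \<le> (10^5 * d) ^ 3 * q" using k by simp
    then have "k ^ 3 \<le> (10^5 * d) ^ 3" using q by simp
    then show ?thesis
      using power_mono_iff[of k "10^5 * d" 3] k(1) d0 by (simp only:) simp
  qed
  then have "1 / 10^5 * k \<le> d" by simp
  then show "1 / 10^5 * real q powr (-1/3) \<le> supnorm (real q *\<^sub>R ?v - p)"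
    unfolding k_def d_def .
qed simp

section \<open>Improving Dirichlet's theorem along the golden line\<close>

lemma nn_integral_lborel_pair:
  fixes f :: "'a::euclidean_space \<times> 'b::euclidean_space \<Rightarrow> ennreal"
  assumes "f \<in> borel_measurable borel"
  shows "(\<integral>\<^sup>+z. f z \<partial>lborel) = (\<integral>\<^sup>+x. \<integral>\<^sup>+y. f (x, y) \<partial>lborel \<partial>lborel)"
proof -
  have "f \<in> borel_measurable (lborel \<Otimes>\<^sub>M lborel)"
    using assms unfolding lborel_prod by simp
  from lborel.nn_integral_fst[OF this] show ?thesis
    by (simp add: lborel_prod)
qed

lemma nn_integral_lborel_quadruple:
  fixes f :: "real \<times> real \<times> real \<times> real \<Rightarrow> ennreal"
  assumes f: "f \<in> borel_measurable borel"
  shows "(\<integral>\<^sup>+z. f z \<partial>lborel) =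
    (\<integral>\<^sup>+q. \<integral>\<^sup>+a. \<integral>\<^sup>+b. \<integral>\<^sup>+t. f (q, a, b, t) \<partial>lborel \<partial>lborel \<partial>lborel \<partial>lborel)"
proof -
  have slice: "(\<lambda>y. g (x, y)) \<in> borel_measurable borel"
    if "g \<in> borel_measurable borel" for g :: "real \<times> 'c::euclidean_space \<Rightarrow> ennreal" and x
    by (rule measurable_compose[OF _ that]) (simp add: borel_prod[symmetric])
  show ?thesis
    by (subst nn_integral_lborel_pair, (intro f slice)?)+ (rule refl)
qed

text \<open>If \<open>q\<close> were 0, each of the other integers would have absolute value below 1
  and the vector would vanish. Multiplying the whole vector by \<open>sgn q\<close> then makes the
  denominator positive.\<close>

lemma DI_witness:
  fixes q p1 p2 p3 x1 x2 x3 Q R \<sigma> :: real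
  assumes int: "q \<in> \<int>" "p1 \<in> \<int>" "p2 \<in> \<int>" "p3 \<in> \<int>"
    and nz: "\<not> (q = 0 \<and> p1 = 0 \<and> p2 = 0 \<and> p3 = 0)"
    and Q: "0 < Q" and R: "1 \<le> R" and \<sigma>: "\<sigma> < 1"
    and le: "\<bar>q / Q\<bar> < \<sigma>" "\<bar>R * (q * x1 - p1)\<bar> < \<sigma>" "\<bar>R * (q * x2 - p2)\<bar> < \<sigma>"
      "\<bar>R * (q * x3 - p3)\<bar> < \<sigma>"
  shows "\<exists>n::nat. \<exists>p. 1 \<le> n \<and> int_vec p \<and>
    supnorm (real n *\<^sub>R vector [x1, x2, x3] - p) < \<sigma> / R \<and> real n < \<sigma> * Q"
proof -
  have "q \<noteq> 0"
  proof
    assume q: "q = 0"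
    have "p = 0" if "p \<in> \<int>" "\<bar>R * (q * x - p)\<bar> < \<sigma>" for p x
    proof -
      have "\<bar>p\<bar> \<le> R * \<bar>p\<bar>" using R by (simp add: mult_le_cancel_right1)
      also have "\<dots> < 1" using that(2) \<sigma> R q by (simp add: abs_mult)
      finally show ?thesis using that(1) by (auto elim!: Ints_cases)
    qed
    then show False using int le nz q by blast
  qed
  define n where "n = nat \<lfloor>\<bar>q\<bar>\<rfloor>"
  have n: "real n = sgn q * q" "1 \<le> n"
    using int(1) \<open>q \<noteq> 0\<close> by (auto simp: n_def sgn_if nat_le_iff le_nat_iff simp flip: of_int_abs elim!: Ints_cases)
  let ?p = "vector [sgn q * p1, sgn q * p2, sgn q * p3] :: real^3"
  have "sgn q \<in> \<int>" by (simp add: sgn_if)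
  then have "int_vec ?p"
    using int by (simp add: int_vec_def forall_3)
  moreover have "supnorm (real n *\<^sub>R vector [x1, x2, x3] - ?p) < \<sigma> / R"
  proof -
    have "\<bar>real n * x - sgn q * p\<bar> < \<sigma> / R" if "\<bar>R * (q * x - p)\<bar> < \<sigma>" for x p
    proof -
      have "\<bar>real n * x - sgn q * p\<bar> = \<bar>q * x - p\<bar>"
        using \<open>q \<noteq> 0\<close> unfolding n by (simp add: sgn_if abs_minus_commute algebra_simps)
      then show ?thesis using that R by (simp add: abs_mult pos_less_divide_eq mult.commute)
    qed
    then show ?thesis using le by (simp add: supnorm_less_iff forall_3)
  qed
  moreover have "real n < \<sigma> * Q"
    using le(1) Q n by (simp add: pos_divide_less_eq abs_sgn mult.commute)
  ultimately show ?thesis using n(2) by blast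
qed

text \<open>Minkowski's theorem, assembled from \<open>body_volume\<close>,
  \<open>blichfeldt\<close> and \<open>body_diff\<close>, gives a nonzero integer vector in the body
  of size \<open>2 * h\<close>. One of the three alternatives of \<open>golden_multiple\<close> then
  provides the witness for \<open>Q\<close>.\<close>

lemma golden_line_in_DI:
  assumes x: "\<bar>x\<bar> \<le> 1/1000"
  shows "vector [x, golden, golden * x] \<in> DI (995/1000)"
proof -
  let ?g = golden
  have g: "1.618 < ?g" "?g < 1.619" by (fact golden_bounds)+
  have gg: "?g * ?g = ?g + 1" by (rule golden_sq)
  have "\<exists>q::nat. \<exists>p. 1 \<le> q \<and> int_vec p \<and>
      supnorm (real q *\<^sub>R vector [x, ?g, ?g * x] - p) < 995/1000 * Q powr (-1/3) \<and> real q < 995/1000 * Q"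
    if Q: "10000 \<le> Q" for Q
  proof -
    define R where "R = Q powr (1/3)"
    have R: "1 \<le> R" "R ^ 3 = Q" "Q powr (-1/3) = 1 / R"
    proof -
      show "1 \<le> R" using Q by (simp add: R_def ge_one_powr_ge_zero)
      show "R ^ 3 = Q" using Q by (simp add: R_def powr_powr flip: powr_realpow)
      show "Q powr (-1/3) = 1 / R" by (simp add: R_def powr_minus_divide)
    qed
    \<comment> \<open>The value must be large enough for the body to have volume above 1, and small
      enough that \<open>1004/1000 * (2 * h) < 995/1000\<close>.\<close>
    define h :: real where "h = 495/1000"
    define F where "F = (\<lambda>(q,a,b,t). body h (q / Q) (R * (q * x - a)) (R * (q * (?g * x) - b)) (R * (q * ?g - t)))"
    define S where "S = {z. F z}"
    have F_meas [measurable]: "Measurable.pred (borel \<Otimes>\<^sub>M borel \<Otimes>\<^sub>M borel \<Otimes>\<^sub>M borel) F"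
      unfolding F_def by measurable
    have S: "S \<in> sets borel"
    proof -
      have "S \<in> sets (borel \<Otimes>\<^sub>M borel \<Otimes>\<^sub>M borel \<Otimes>\<^sub>M borel)"
        unfolding S_def using predE[OF F_meas] by (simp add: space_pair_measure)
      then show ?thesis unfolding borel_prod .
    qed
    have "1 < (56 * ?g - 40) / 3 * h ^ 4"
    proof -
      have "1 < (56 * 1.618 - 40) / 3 * h ^ 4" by (simp add: h_def power4_eq_xxxx)
      also have "\<dots> \<le> (56 * ?g - 40) / 3 * h ^ 4" using g by (intro mult_right_mono) (auto simp: h_def)
      finally show ?thesis .
    qed
    then have "1 < ennreal ((56 * ?g - 40) / 3 * h ^ 4)"
      by (metis ennreal_1 ennreal_lessI less_trans zero_less_one)
    also have "\<dots> \<le> (\<integral>\<^sup>+s. \<integral>\<^sup>+a. \<integral>\<^sup>+b. \<integral>\<^sup>+t. indicator {t. body h s a b t} t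
        \<partial>lborel \<partial>lborel \<partial>lborel \<partial>lborel)"
      by (rule body_volume) (simp add: h_def)
    also have "\<dots> = (\<integral>\<^sup>+s. \<integral>\<^sup>+a. \<integral>\<^sup>+b. \<integral>\<^sup>+t. indicator {(s,a,b,t). body h s a b t} (s,a,b,t)
        \<partial>lborel \<partial>lborel \<partial>lborel \<partial>lborel)"
      by (simp add: indicator_def)
    also have "\<dots> = (\<integral>\<^sup>+q. \<integral>\<^sup>+a. \<integral>\<^sup>+b. \<integral>\<^sup>+t. indicator {(s,a,b,t). body h s a b t}
        (q / R^3, R * (q * x - a), R * (q * (?g * x) - b), R * (q * ?g - t))
        \<partial>lborel \<partial>lborel \<partial>lborel \<partial>lborel)"
      using R by (intro nn_integral_unimodular[symmetric]) auto
    also have "\<dots> = (\<integral>\<^sup>+q. \<integral>\<^sup>+a. \<integral>\<^sup>+b. \<integral>\<^sup>+t. indicator S (q,a,b,t)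
        \<partial>lborel \<partial>lborel \<partial>lborel \<partial>lborel)"
      by (simp add: S_def F_def indicator_def R)
    also have "\<dots> = (\<integral>\<^sup>+z. indicator S z \<partial>lborel)"
      using S by (intro nn_integral_lborel_quadruple[symmetric] borel_measurable_indicator)
    also have "\<dots> = emeasure lborel S" using S by simp
    finally have "1 < emeasure lborel S" .
    from blichfeldt[OF S this] obtain z z' where z: "z \<in> S" "z' \<in> S" "z \<noteq> z'"
      and zi: "\<forall>i\<in>Basis. (z - z') \<bullet> i \<in> \<int>" by blast
    \<comment> \<open>The tuple lists the coordinate for \<open>golden * x\<close> before that for
      \<open>golden\<close>, hence \<open>p3\<close> before \<open>p2\<close>.\<close>
    obtain q p1 p3 p2 where d: "z - z' = (q, p1, p3, p2)" by (metis surj_pair)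
    have int: "q \<in> \<int>" "p1 \<in> \<int>" "p2 \<in> \<int>" "p3 \<in> \<int>"
      using zi unfolding d by (auto simp: Basis_prod_def)
    have nz: "\<not> (q = 0 \<and> p1 = 0 \<and> p2 = 0 \<and> p3 = 0)"
      using d z(3) by (auto simp: zero_prod_def[symmetric])
    define s a b t where "s = q / Q" and "a = R * (q * x - p1)"
      and "b = R * (q * (?g * x) - p3)" and "t = R * (q * ?g - p2)"
    let ?r = "2 * h"
    have "body ?r s a b t"
    proof -
      obtain q1 u1 w1 v1 where z1: "z = (q1, u1, w1, v1)" by (metis surj_pair)
      obtain q2 u2 w2 v2 where z2: "z' = (q2, u2, w2, v2)" by (metis surj_pair)
      have e: "q = q1 - q2" "p1 = u1 - u2" "p3 = w1 - w2" "p2 = v1 - v2"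
        using d z1 z2 by auto
      have "s = q1 / Q - q2 / Q" "a = R * (q1 * x - u1) - R * (q2 * x - u2)"
        "b = R * (q1 * (?g * x) - w1) - R * (q2 * (?g * x) - w2)"
        "t = R * (q1 * ?g - v1) - R * (q2 * ?g - v2)"
        by (simp_all add: s_def a_def b_def t_def e diff_divide_distrib algebra_simps)
      then show ?thesis
        using body_diff[OF z(1)[unfolded S_def z1 F_def mem_Collect_eq prod.case]
              z(2)[unfolded S_def z2 F_def mem_Collect_eq prod.case]] by simp
    qed
    then have ab: "\<bar>a\<bar> \<le> ?r" "\<bar>b\<bar> \<le> ?r" and K: "\<bar>s\<bar> + \<bar>t\<bar> \<le> ?g * ?r"
      "\<bar>t\<bar> + (?g - 1) * \<bar>a + b\<bar> \<le> ?g * ?r" "\<bar>s\<bar> + (?g - 1) * \<bar>a - b\<bar> \<le> ?g * ?r"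
      unfolding body_def by blast+
    \<comment> \<open>The new denominator is close to \<open>p2\<close>, and \<open>p2 / Q\<close>
      differs from \<open>golden * s\<close> by exactly \<open>t / (Q * R)\<close>. The threshold
      10000 for \<open>Q\<close> keeps this error small.\<close>
    define e where "e = 1 / (Q * R)"
    have e: "\<bar>e\<bar> * (?g * ?r) \<le> ?r / 1000"
    proof -
      have "10000 * 1 \<le> Q * R" using Q R by (intro mult_mono) auto
      then have "e \<le> 1 / 10000" unfolding e_def by (intro divide_left_mono) auto
      moreover have "0 \<le> e" using Q R by (simp add: e_def)
      ultimately have "\<bar>e\<bar> * (?g * ?r) \<le> 1/10000 * (2 * ?r)"
        using g by (intro mult_mono) (auto simp: h_def)
      then show ?thesis by (simp add: h_def)
    qed
    have eR: "e * (R * w) = w / Q" for w using R by (simp add: e_def)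
    have "?r > 0" by (simp add: h_def)
    have W: ?thesis
      if "q' \<in> \<int>" "p1' \<in> \<int>" "p2' \<in> \<int>" "p3' \<in> \<int>"
        "\<not> (q' = 0 \<and> p1' = 0 \<and> p2' = 0 \<and> p3' = 0)"
        "\<bar>q' / Q\<bar> < 995/1000" "\<bar>R * (q' * x - p1')\<bar> < 995/1000" "\<bar>R * (q' * ?g - p2')\<bar> < 995/1000"
        "\<bar>R * (q' * (?g * x) - p3')\<bar> < 995/1000" for q' p1' p2' p3'
      using DI_witness[OF that(1-5) _ R(1) _ that(6-9)] Q R(3) by simp
    have lt: "\<bar>u\<bar> < 995/1000" if "\<bar>u\<bar> \<le> ?r" for u :: real
      using that by (simp add: h_def)
    have lt': "\<bar>u\<bar> < 995/1000" if "\<bar>u\<bar> \<le> 1004/1000 * ?r" for u :: real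
      using that by (simp add: h_def)
    show ?thesis
    proof (rule golden_multiple[OF \<open>?r > 0\<close> x e ab K])
      assume s: "\<bar>s\<bar> \<le> ?r" and t: "\<bar>t\<bar> \<le> ?r"
      show ?thesis
        by (rule W[OF int nz lt[OF s[unfolded s_def]] lt[OF ab(1)[unfolded a_def]]
              lt[OF t[unfolded t_def]] lt[OF ab(2)[unfolded b_def]]])
    next
      assume 1: "\<bar>?g * s - e * t\<bar> \<le> 1004/1000 * ?r" "\<bar>(1 - ?g) * t\<bar> \<le> ?r"
        "\<bar>b - x * t\<bar> \<le> 1004/1000 * ?r" "\<bar>a + b - ?g * x * t\<bar> \<le> 1004/1000 * ?r"
      \<comment> \<open>The coordinates belong to the image \<open>(p2, p3, q + p2, p1 + p3)\<close>
        under the map A, which vanishes only if the original vector does.\<close>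
      have image: "?g * s - e * t = p2 / Q" "(1 - ?g) * t = R * (p2 * ?g - (q + p2))"
        "b - x * t = R * (p2 * x - p3)" "a + b - ?g * x * t = R * (p2 * (?g * x) - (p1 + p3))"
      proof -
        show "?g * s - e * t = p2 / Q"
          unfolding s_def t_def eR by (simp add: diff_divide_distrib)
        show "(1 - ?g) * t = R * (p2 * ?g - (q + p2))"
          unfolding t_def using gg by algebra
        show "b - x * t = R * (p2 * x - p3)"
          unfolding b_def t_def by algebra
        show "a + b - ?g * x * t = R * (p2 * (?g * x) - (p1 + p3))"
          unfolding a_def b_def t_def using gg by algebra
      qed
      show ?thesis
      proof (rule W)
        show "\<not> (p2 = 0 \<and> p3 = 0 \<and> q + p2 = 0 \<and> p1 + p3 = 0)" using nz by auto
      qed (use int 1[unfolded image] in \<open>blast intro: Ints_add lt lt'\<close>)+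
    next
      assume 1: "\<bar>(?g - 1) * s - e * t\<bar> \<le> 1004/1000 * ?r" "\<bar>- ?g * t\<bar> \<le> ?r"
        "\<bar>b - a - x * t\<bar> \<le> 1004/1000 * ?r" "\<bar>a - ?g * x * t\<bar> \<le> 1004/1000 * ?r"
      \<comment> \<open>Here the vector is the image \<open>(p2 - q, p3 - p1, q, p1)\<close> under
        the inverse of A.\<close>
      have image: "(?g - 1) * s - e * t = (p2 - q) / Q" "- ?g * t = R * ((p2 - q) * ?g - q)"
        "b - a - x * t = R * ((p2 - q) * x - (p3 - p1))" "a - ?g * x * t = R * ((p2 - q) * (?g * x) - p1)"
      proof -
        show "(?g - 1) * s - e * t = (p2 - q) / Q"
          unfolding s_def t_def eR by (simp add: diff_divide_distrib algebra_simps)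
        show "- ?g * t = R * ((p2 - q) * ?g - q)"
          unfolding t_def using gg by algebra
        show "b - a - x * t = R * ((p2 - q) * x - (p3 - p1))"
          unfolding a_def b_def t_def by algebra
        show "a - ?g * x * t = R * ((p2 - q) * (?g * x) - p1)"
          unfolding a_def t_def using gg by algebra
      qed
      show ?thesis
      proof (rule W)
        show "\<not> (p2 - q = 0 \<and> p3 - p1 = 0 \<and> q = 0 \<and> p1 = 0)" using nz by auto
      qed (use int 1[unfolded image] in \<open>blast intro: Ints_diff lt lt'\<close>)+
    qed
  qed
  then show ?thesis unfolding DI_def by blast
qed

section \<open>The segment on the golden line\<close>

theorem theorem5p1:
  shows "\<exists>a b :: real^3. a \<noteq> b \<and>
           (\<exists>v\<in>closed_segment a b. badly_approximable v) \<and>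
           (\<forall>v\<in>closed_segment a b. \<exists>\<sigma>. 0 < \<sigma> \<and> \<sigma> < 1 \<and> v \<in> DI \<sigma>)"
proof -
  let ?v = "\<lambda>x. vector [x, golden, golden * x] :: real^3"
  have line: "(1 - u) *\<^sub>R ?v 0 + u *\<^sub>R ?v (1/1000) = ?v (u / 1000)" for u
    by (simp add: vec_eq_iff forall_3 algebra_simps)
  have seg: "closed_segment (?v 0) (?v (1/1000)) = {?v (u / 1000) | u. 0 \<le> u \<and> u \<le> 1}"
    unfolding closed_segment_def line by auto
  have "?v 0 \<noteq> ?v (1/1000)"
    by (simp add: vec_eq_iff forall_3)
  moreover have "\<exists>v\<in>closed_segment (?v 0) (?v (1/1000)). badly_approximable v"
  proof
    \<comment> \<open>The point has parameter \<open>sqrt 2 / 2\<close> on the segment; the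
      denominator 2000 was chosen to keep it within the range of \<open>x\<close> covered by
      \<open>golden_line_in_DI\<close>.\<close>
    show "badly_approximable (?v (sqrt 2 / 2000))" by (rule badly_approximable_quartic)
    have "sqrt 2 \<le> 2" by (rule real_le_lsqrt) simp_all
    then have "?v (sqrt 2 / 2000) = ?v ((sqrt 2 / 2) / 1000)" "0 \<le> sqrt 2 / 2" "sqrt 2 / 2 \<le> 1"
      by simp_all
    then show "?v (sqrt 2 / 2000) \<in> closed_segment (?v 0) (?v (1/1000))"
      unfolding seg by blast
  qed
  moreover have "v \<in> DI (995/1000)" if v: "v \<in> closed_segment (?v 0) (?v (1/1000))" for v
  proof -
    obtain u where "v = ?v (u / 1000)" "0 \<le> u" "u \<le> 1" using v unfolding seg by blast
    then show ?thesis using golden_line_in_DI[of "u / 1000"] by simp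
  qed
  moreover have "0 < (995/1000 :: real)" "995/1000 < (1 :: real)" by simp_all
  ultimately show ?thesis by blast
qed

end
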